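(* Let $\Omega$ be a bounded domain of $\mathbb{R}^N$, $F\in \mathrm{C}^1(\mathbb{R})$, $g\in \mathrm{C}(\partial\Omega)$ a non-constant function, and $\mathcal{H}:=\{u\in \mathrm{C}^2(\Omega)\cap \mathrm{C}^1(\overline\Omega):\ u|_{\partial\Omega}=g\}$. Let $L(u,z)=\tfrac12|z|^2+F(u)$ for $(u,z)\in\mathbb{R}\times\mathbb{R}^N$. Then the Euler-Lagrange and Noether equations for $L$ are equivalent in $\mathcal{H}$; that is, for every $u\in\mathcal{H}$, $u$ satisfies $$\Delta u=F'(u)\quad\text{in }\Omega$$ if and only if $u$ satisfies $$\sum_{j=1}^N \frac{\partial}{\partial x_j}\left(\frac{\partial u}{\partial x_i}\frac{\partial u}{\partial x_j}-\delta_{ij}L(u,Du)\right)=0\quad\text{in }\Omega\text{ for all } i=1,\dots,N.$$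
   Context: A domain is an open connected subset of $\mathbb{R}^N$. Functions are real-valued. $\mathrm{C}^1(\overline\Omega)$ denotes the set of restrictions to $\Omega$ of continuously differentiable functions on $\mathbb{R}^N$; the boundary values $u|_{\partial\Omega}$ are those of the continuous extension of $u$ to $\overline\Omega$. $\delta_{ij}$ is the Kronecker delta. *)

theory Defs
  imports "HOL-Analysis.Analysis"
begin

definition domain :: "(real^'n) set \<Rightarrow> bool" where
  "domain \<Omega> \<longleftrightarrow> open \<Omega> \<and> connected \<Omega>"

definition partial_deriv :: "'n \<Rightarrow> (real^'n \<Rightarrow> real) \<Rightarrow> real^'n \<Rightarrow> real" where
  "partial_deriv i f x = deriv (\<lambda>t. f (x + t *\<^sub>R axis i 1)) 0"

definition gradient :: "(real^'n \<Rightarrow> real) \<Rightarrow> real^'n \<Rightarrow> real^'n" where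
  "gradient f x = (\<chi> i. partial_deriv i f x)"

definition laplacian :: "(real^'n \<Rightarrow> real) \<Rightarrow> real^'n \<Rightarrow> real" where
  "laplacian f x = (\<Sum>i\<in>UNIV. partial_deriv i (partial_deriv i f) x)"

text \<open>Functions of class \<open>C\<^sup>k\<close> on a set, meant for open sets only, where for \<open>k \<ge> 1\<close> this agrees
  with existence and continuity of all partial derivatives up to order \<open>k\<close>; the values of the function
  off the set are then irrelevant.\<close>

primrec Ck_on :: "nat \<Rightarrow> (real^'n) set \<Rightarrow> (real^'n \<Rightarrow> real) \<Rightarrow> bool" where
  "Ck_on 0 S f \<longleftrightarrow> continuous_on S f"
| "Ck_on (Suc k) S f \<longleftrightarrow> f differentiable_on S \<and> (\<forall>i. Ck_on k S (partial_deriv i f))"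

text \<open>The space \<open>C\<^sup>1\<close> of the closure of \<open>\<Omega>\<close>: restrictions to \<open>\<Omega>\<close> of continuously
  differentiable functions on the whole space. As functions are total in HOL, this only
  constrains the values on \<open>\<Omega>\<close>.\<close>

definition C1_closure :: "(real^'n) set \<Rightarrow> (real^'n \<Rightarrow> real) \<Rightarrow> bool" where
  "C1_closure \<Omega> u \<longleftrightarrow> (\<exists>v. Ck_on 1 UNIV v \<and> (\<forall>x\<in>\<Omega>. u x = v x))"

definition has_boundary_values ::
    "(real^'n) set \<Rightarrow> (real^'n \<Rightarrow> real) \<Rightarrow> (real^'n \<Rightarrow> real) \<Rightarrow> bool" where
  "has_boundary_values \<Omega> u g \<longleftrightarrow>
     (\<exists>U. continuous_on (closure \<Omega>) U \<and> (\<forall>x\<in>\<Omega>. U x = u x) \<and> (\<forall>x\<in>frontier \<Omega>. U x = g x))"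

definition admissible :: "(real^'n) set \<Rightarrow> (real^'n \<Rightarrow> real) \<Rightarrow> (real^'n \<Rightarrow> real) set" where
  "admissible \<Omega> g = {u. Ck_on 2 \<Omega> u \<and> C1_closure \<Omega> u \<and> has_boundary_values \<Omega> u g}"

definition lagrangian :: "(real \<Rightarrow> real) \<Rightarrow> real \<Rightarrow> real^'n \<Rightarrow> real" where
  "lagrangian F u z = 1/2 * (norm z)\<^sup>2 + F u"

definition kronecker :: "'n \<Rightarrow> 'n \<Rightarrow> real" where
  "kronecker i j = (if i = j then 1 else 0)"

end

theory Submission
  imports Defs
begin

text \<open>By the product rule and the symmetry of second derivatives, the left-hand side of the
  \<open>i\<close>-th Noether equation equals \<open>(\<Delta>u - F'(u)) \<partial>\<^sub>iu\<close>. Hence, if the Noether equations hold, \<open>Du\<close>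
  vanishes on the open set where \<open>\<Delta>u \<noteq> F'(u)\<close>. If this set contained a point with value \<open>c\<close> of
  \<open>u\<close>, then \<open>F'(c) \<noteq> 0\<close>, and \<open>{u = c, \<Delta>u = 0}\<close> would be open and closed in \<open>\<Omega>\<close>. So \<open>u\<close> and with
  it \<open>g\<close> would be constant.\<close>

section \<open>Partial derivatives as derivatives along coordinate lines\<close>

lemma has_real_derivative_along_axis:
  fixes f :: "real^'n \<Rightarrow> real"
  assumes f': "(f has_derivative f') (at (x + t *\<^sub>R axis i 1))"
  shows "((\<lambda>t. f (x + t *\<^sub>R axis i 1)) has_real_derivative f' (axis i 1)) (at t)"
proof -
  have "((\<lambda>t. x + t *\<^sub>R axis i 1) has_derivative (\<lambda>t. t *\<^sub>R axis i 1)) (at t)"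
    by (auto intro!: derivative_eq_intros)
  then have "((\<lambda>t. f (x + t *\<^sub>R axis i 1)) has_derivative (\<lambda>t. f' (t *\<^sub>R axis i 1))) (at t)"
    by (rule has_derivative_compose) (rule f')
  moreover have "(\<lambda>t. f' (t *\<^sub>R axis i 1)) = (*) (f' (axis i 1))"
    by (simp add: fun_eq_iff linear_cmul[OF has_derivative_linear[OF f']])
  ultimately show ?thesis
    by (simp add: has_field_derivative_def)
qed

lemma partial_deriv_eq_derivative:
  fixes f :: "real^'n \<Rightarrow> real"
  assumes "(f has_derivative f') (at x)"
  shows "partial_deriv i f x = f' (axis i 1)"
  unfolding partial_deriv_def
  by (rule DERIV_imp_deriv, rule has_real_derivative_along_axis) (use assms in simp)

text \<open>\<open>partial_deriv\<close> differentiates at parameter 0 only. The mean value theorem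
  along a segment needs the derivative at every parameter, which is the partial derivative at the
  moved base point.\<close>

lemma has_real_derivative_partial_deriv:
  fixes f :: "real^'n \<Rightarrow> real"
  assumes "f differentiable (at (x + t *\<^sub>R axis i 1))"
  shows "((\<lambda>t. f (x + t *\<^sub>R axis i 1)) has_real_derivative
           partial_deriv i f (x + t *\<^sub>R axis i 1)) (at t)"
proof -
  obtain f' where f': "(f has_derivative f') (at (x + t *\<^sub>R axis i 1))"
    using assms by (auto simp: differentiable_def)
  show ?thesis
    unfolding partial_deriv_eq_derivative[OF f'] by (rule has_real_derivative_along_axis[OF f'])
qed

lemma has_real_derivative_partial_deriv_0:
  fixes f :: "real^'n \<Rightarrow> real"
  assumes "f differentiable (at x)"
  shows "((\<lambda>t. f (x + t *\<^sub>R axis i 1)) has_real_derivative partial_deriv i f x) (at 0)"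
  using has_real_derivative_partial_deriv[of f x 0 i] assms by simp

text \<open>A linear map that vanishes on the standard basis is zero. This turns a vanishing
  gradient into local constancy later on.\<close>

lemma has_derivative_zero_if_partial_derivs_zero:
  fixes f :: "real^'n \<Rightarrow> real"
  assumes "f differentiable (at x)" and "\<And>i. partial_deriv i f x = 0"
  shows "(f has_derivative (\<lambda>h. 0)) (at x)"
proof -
  obtain f' where f': "(f has_derivative f') (at x)"
    using assms(1) by (auto simp: differentiable_def)
  have "f' (axis i 1) = 0" for i
    using partial_deriv_eq_derivative[OF f'] assms(2) by simp
  then have "f' = (\<lambda>h. 0)"
    by (intro linear_eq_stdbasis[OF has_derivative_linear[OF f']] linear_zero)
      (auto simp: Basis_vec_def)
  then show ?thesis
    using f' by simp
qed

lemma partial_deriv_eq_0_if_zero_on_open: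
  fixes f :: "real^'n \<Rightarrow> real"
  assumes "open S" "x \<in> S" "\<And>y. y \<in> S \<Longrightarrow> f y = 0"
  shows "partial_deriv i f x = 0"
proof -
  have "(f has_derivative (\<lambda>h. 0)) (at x)"
    by (rule has_derivative_transform_within_open[OF has_derivative_const assms(1,2)])
      (simp add: assms(3))
  then show ?thesis
    by (rule partial_deriv_eq_derivative)
qed

section \<open>Symmetry of second partial derivatives\<close>

text \<open>The second difference is the increment over \<open>[0, h]\<close> of a first difference
  in direction \<open>j\<close>, regarded as a function of the step in direction \<open>i\<close>.
  The mean value theorem is applied first in direction \<open>i\<close>, then to
  \<open>partial_deriv i f\<close> in direction \<open>j\<close>; each application contributes one
  factor \<open>h\<close>.\<close>

lemma second_difference_mean_value:
  fixes f :: "real^'n \<Rightarrow> real"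
  assumes h: "0 < h"
    and square: "\<And>s t. \<lbrakk>0 \<le> s; s \<le> h; 0 \<le> t; t \<le> h\<rbrakk> \<Longrightarrow> x + s *\<^sub>R axis i 1 + t *\<^sub>R axis j 1 \<in> S"
    and f: "\<And>y. y \<in> S \<Longrightarrow> f differentiable (at y)"
    and fi: "\<And>y. y \<in> S \<Longrightarrow> partial_deriv i f differentiable (at y)"
  obtains s t where "0 < s" "s < h" "0 < t" "t < h"
    "f (x + h *\<^sub>R axis i 1 + h *\<^sub>R axis j 1) - f (x + h *\<^sub>R axis i 1)
       - f (x + h *\<^sub>R axis j 1) + f x
     = h\<^sup>2 * partial_deriv j (partial_deriv i f) (x + s *\<^sub>R axis i 1 + t *\<^sub>R axis j 1)"
proof -
  let ?a = "axis i 1 :: real^'n" and ?b = "axis j 1 :: real^'n"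
  have "((\<lambda>s. f (x + h *\<^sub>R ?b + s *\<^sub>R ?a) - f (x + s *\<^sub>R ?a)) has_real_derivative
      partial_deriv i f (x + h *\<^sub>R ?b + s *\<^sub>R ?a) - partial_deriv i f (x + s *\<^sub>R ?a)) (at s)"
    if "0 \<le> s" "s \<le> h" for s
    using square[of s h] square[of s 0] that h
    by (intro DERIV_diff has_real_derivative_partial_deriv f) (simp_all add: add_ac)
  from MVT2[OF h this] obtain s where s: "0 < s" "s < h" and s_eq:
    "f (x + h *\<^sub>R ?b + h *\<^sub>R ?a) - f (x + h *\<^sub>R ?a) - (f (x + h *\<^sub>R ?b + 0 *\<^sub>R ?a) - f (x + 0 *\<^sub>R ?a))
     = (h - 0) * (partial_deriv i f (x + h *\<^sub>R ?b + s *\<^sub>R ?a) - partial_deriv i f (x + s *\<^sub>R ?a))"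
    by blast
  have "((\<lambda>t. partial_deriv i f (x + s *\<^sub>R ?a + t *\<^sub>R ?b)) has_real_derivative
      partial_deriv j (partial_deriv i f) (x + s *\<^sub>R ?a + t *\<^sub>R ?b)) (at t)"
    if "0 \<le> t" "t \<le> h" for t
    using square[of s t] s that by (intro has_real_derivative_partial_deriv fi) simp
  from MVT2[OF h this] obtain t where t: "0 < t" "t < h" and t_eq:
    "partial_deriv i f (x + s *\<^sub>R ?a + h *\<^sub>R ?b) - partial_deriv i f (x + s *\<^sub>R ?a + 0 *\<^sub>R ?b)
     = (h - 0) * partial_deriv j (partial_deriv i f) (x + s *\<^sub>R ?a + t *\<^sub>R ?b)"
    by blast
  show thesis
    using s_eq t_eq by (intro that[OF s t]) (simp add: add_ac power2_eq_square)
qed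

text \<open>The second difference does not change when \<open>i\<close> and \<open>j\<close> are
  swapped, so the two mixed derivatives agree at some pair of points near \<open>x\<close>.
  Continuity carries this over to \<open>x\<close> itself.\<close>

lemma partial_deriv_commute:
  fixes f :: "real^'n \<Rightarrow> real"
  assumes S: "open S" "x \<in> S"
    and f: "\<And>y. y \<in> S \<Longrightarrow> f differentiable (at y)"
    and fd: "\<And>i y. y \<in> S \<Longrightarrow> partial_deriv i f differentiable (at y)"
    and cont: "\<And>i j. continuous_on S (partial_deriv j (partial_deriv i f))"
  shows "partial_deriv j (partial_deriv i f) x = partial_deriv i (partial_deriv j f) x"
proof (rule ccontr)
  let ?A = "partial_deriv j (partial_deriv i f)" and ?B = "partial_deriv i (partial_deriv j f)"
  \<comment> \<open>Half the gap: a common value within \<open>e\<close> of both \<open>?A x\<close>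
    and \<open>?B x\<close> would make the gap smaller than itself.\<close>
  define e where "e = \<bar>?A x - ?B x\<bar> / 2"
  assume "?A x \<noteq> ?B x"
  then have "0 < e"
    by (simp add: e_def)
  have "continuous (at x) ?A" "continuous (at x) ?B"
    using cont S continuous_on_eq_continuous_at by blast+
  then obtain d1 d2 where d: "0 < d1" "\<And>y. dist y x < d1 \<Longrightarrow> dist (?A y) (?A x) < e"
      "0 < d2" "\<And>y. dist y x < d2 \<Longrightarrow> dist (?B y) (?B x) < e"
    using \<open>0 < e\<close> unfolding continuous_at_eps_delta by metis
  obtain d3 where d3: "0 < d3" "ball x d3 \<subseteq> S"
    using S open_contains_ball by blast
  \<comment> \<open>Points of the square of side \<open>h\<close> lie within \<open>2 * h\<close> of
    its corner \<open>x\<close>; dividing by 3 keeps this strictly below all three radii.\<close>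
  define h where "h = min d1 (min d2 d3) / 3"
  have h: "0 < h" "2 * h < d1" "2 * h < d2" "2 * h < d3"
    using d(1,3) d3(1) unfolding h_def by (simp_all add: min_def)
  have close: "dist (x + s *\<^sub>R axis k 1 + t *\<^sub>R axis l 1) x \<le> 2 * h"
    if "0 \<le> s" "s \<le> h" "0 \<le> t" "t \<le> h" for s t k l
    using norm_triangle_ineq[of "s *\<^sub>R axis k 1 :: real^'n" "t *\<^sub>R axis l 1"] that
    by (simp add: dist_norm add.assoc)
  have square: "x + s *\<^sub>R axis k 1 + t *\<^sub>R axis l 1 \<in> S"
    if "0 \<le> s" "s \<le> h" "0 \<le> t" "t \<le> h" for s t k l
    using close[OF that, of k l] h(4) d3(2) by (auto simp: dist_commute)
  obtain s t where st: "0 < s" "s < h" "0 < t" "t < h" and A: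
    "f (x + h *\<^sub>R axis i 1 + h *\<^sub>R axis j 1) - f (x + h *\<^sub>R axis i 1)
       - f (x + h *\<^sub>R axis j 1) + f x = h\<^sup>2 * ?A (x + s *\<^sub>R axis i 1 + t *\<^sub>R axis j 1)"
    by (rule second_difference_mean_value[OF h(1) square f fd, of i j])
  obtain s' t' where st': "0 < s'" "s' < h" "0 < t'" "t' < h" and B:
    "f (x + h *\<^sub>R axis j 1 + h *\<^sub>R axis i 1) - f (x + h *\<^sub>R axis j 1)
       - f (x + h *\<^sub>R axis i 1) + f x = h\<^sup>2 * ?B (x + s' *\<^sub>R axis j 1 + t' *\<^sub>R axis i 1)"
    by (rule second_difference_mean_value[OF h(1) square f fd, of j i])
  have "h\<^sup>2 * ?A (x + s *\<^sub>R axis i 1 + t *\<^sub>R axis j 1) = h\<^sup>2 * ?B (x + s' *\<^sub>R axis j 1 + t' *\<^sub>R axis i 1)"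
    using A B add.commute[of "h *\<^sub>R axis i 1" "h *\<^sub>R axis j 1 :: real^'n"]
    by (simp only: add.assoc)
  then have "?A (x + s *\<^sub>R axis i 1 + t *\<^sub>R axis j 1) = ?B (x + s' *\<^sub>R axis j 1 + t' *\<^sub>R axis i 1)"
    using h(1) by simp
  moreover have "dist (?A (x + s *\<^sub>R axis i 1 + t *\<^sub>R axis j 1)) (?A x) < e"
    using close[of s t i j] st h by (intro d(2)) simp
  moreover have "dist (?B (x + s' *\<^sub>R axis j 1 + t' *\<^sub>R axis i 1)) (?B x) < e"
    using close[of s' t' j i] st' h by (intro d(4)) simp
  ultimately show False
    unfolding e_def dist_real_def by argo
qed

section \<open>The divergence in the Noether equations\<close>

text \<open>\<open>differentiable_on\<close> speaks of derivatives within \<open>S\<close>; for open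
  \<open>S\<close> these are full derivatives at each point, as the pointwise calculus
  requires.\<close>

lemma Ck_on_2_iff:
  fixes u :: "real^'n \<Rightarrow> real"
  assumes "open S"
  shows "Ck_on 2 S u \<longleftrightarrow>
    (\<forall>x\<in>S. u differentiable (at x)) \<and> (\<forall>i. \<forall>x\<in>S. partial_deriv i u differentiable (at x)) \<and>
    (\<forall>i j. continuous_on S (partial_deriv j (partial_deriv i u)))"
proof -
  have "f differentiable_on S \<longleftrightarrow> (\<forall>x\<in>S. f differentiable (at x))" for f :: "real^'n \<Rightarrow> real"
    unfolding differentiable_on_def using at_within_open[OF _ assms] by metis
  then show ?thesis
    by (simp only: numeral_2_eq_2 Ck_on.simps) blast
qed

lemma noether_divergence:
  fixes u :: "real^'n \<Rightarrow> real"
  assumes S: "open S" "x \<in> S" and u: "Ck_on 2 S u"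
    and F: "(F has_real_derivative F') (at (u x))"
  shows "(\<Sum>j\<in>UNIV. partial_deriv j
        (\<lambda>y. partial_deriv i u y * partial_deriv j u y
              - kronecker i j * lagrangian F (u y) (gradient u y)) x)
    = (laplacian u x - F') * partial_deriv i u x"
proof -
  have u1: "u differentiable (at x)" and u2: "partial_deriv k u differentiable (at x)" for k
    using u S by (auto simp: Ck_on_2_iff)
  have sym: "partial_deriv k (partial_deriv l u) x = partial_deriv l (partial_deriv k u) x" for k l
    using u S by (intro partial_deriv_commute[OF S]) (auto simp: Ck_on_2_iff)
  have lag: "lagrangian F (u y) (gradient u y)
      = 1/2 * (\<Sum>k\<in>UNIV. (partial_deriv k u y)\<^sup>2) + F (u y)" for y
    unfolding lagrangian_def power2_norm_eq_inner inner_vec_def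
    by (simp add: gradient_def power2_eq_square)
  have "partial_deriv j (\<lambda>y. partial_deriv i u y * partial_deriv j u y
              - kronecker i j * lagrangian F (u y) (gradient u y)) x
      = partial_deriv j (partial_deriv i u) x * partial_deriv j u x
        + partial_deriv i u x * partial_deriv j (partial_deriv j u) x
        - kronecker i j * ((\<Sum>k\<in>UNIV. partial_deriv k u x * partial_deriv j (partial_deriv k u) x)
            + F' * partial_deriv j u x)" for j
  proof -
    note d1 = has_real_derivative_partial_deriv_0[OF u1, of j]
    note d2 = has_real_derivative_partial_deriv_0[OF u2, of _ j]
    have dF: "((\<lambda>t. F (u (x + t *\<^sub>R axis j 1))) has_real_derivative F' * partial_deriv j u x) (at 0)"
      by (rule DERIV_chain2[OF _ d1]) (use F in simp)
    have "((\<lambda>t. \<Sum>k\<in>UNIV. (partial_deriv k u (x + t *\<^sub>R axis j 1))\<^sup>2) has_real_derivative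
        (\<Sum>k\<in>UNIV. 2 * (partial_deriv k u x * partial_deriv j (partial_deriv k u) x))) (at 0)"
      by (rule DERIV_sum, rule DERIV_cong, rule DERIV_power[OF d2]) simp
    note D = DERIV_diff[OF DERIV_mult[OF d2[of i] d2[of j]]
        DERIV_cmult[OF DERIV_add[OF DERIV_cmult[OF this, of "1/2"] dF], of "kronecker i j"]]
    show ?thesis
      \<comment> \<open>The pattern unfolds only the outer derivative, so the inner partial
        derivatives stay intact for matching with \<open>D\<close>.\<close>
      unfolding partial_deriv_def[of j "\<lambda>y. _ y - _ y"] lag
      by (rule DERIV_imp_deriv, rule DERIV_cong[OF D]) (simp add: sum_distrib_left)
  qed
  \<comment> \<open>Summing over \<open>j\<close>, the Kronecker factor keeps only
    \<open>j = i\<close> in the Lagrangian term.\<close>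
  then have "(\<Sum>j\<in>UNIV. partial_deriv j
        (\<lambda>y. partial_deriv i u y * partial_deriv j u y
              - kronecker i j * lagrangian F (u y) (gradient u y)) x)
    = (\<Sum>j\<in>UNIV. partial_deriv j (partial_deriv i u) x * partial_deriv j u x)
      + partial_deriv i u x * laplacian u x
      - ((\<Sum>k\<in>UNIV. partial_deriv k u x * partial_deriv i (partial_deriv k u) x)
         + F' * partial_deriv i u x)"
    by (simp add: sum.distrib sum_subtractf laplacian_def sum_distrib_left kronecker_def
        if_distrib[of "\<lambda>c. c * _"] cong: if_cong)
  \<comment> \<open>By \<open>sym\<close> the two remaining sums cancel, and
    \<open>partial_deriv i u x\<close> factors out.\<close>
  also have "\<dots> = (laplacian u x - F') * partial_deriv i u x"
    by (simp add: sym[of i] algebra_simps)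
  finally show ?thesis .
qed

section \<open>From the factored equations to the Euler-Lagrange equation\<close>

lemma constant_or_euler_lagrange:
  fixes u :: "real^'n \<Rightarrow> real"
  assumes "open S" "connected S" and u: "Ck_on 2 S u" and f: "continuous_on UNIV f"
    and zero: "\<And>i x. x \<in> S \<Longrightarrow> (laplacian u x - f (u x)) * partial_deriv i u x = 0"
  shows "u constant_on S \<or> (\<forall>x\<in>S. laplacian u x = f (u x))"
proof (intro disjCI)
  assume "\<not> (\<forall>x\<in>S. laplacian u x = f (u x))"
  then obtain x0 where x0: "x0 \<in> S" "laplacian u x0 \<noteq> f (u x0)"
    by blast
  have diff: "u differentiable (at x)" if "x \<in> S" for x
    using u that \<open>open S\<close> by (auto simp: Ck_on_2_iff)
  have cont_u: "continuous_on S u"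
    using diff by (intro continuous_at_imp_continuous_on) (auto intro: differentiable_imp_continuous_within)
  have cont_lap: "continuous_on S (laplacian u)"
    unfolding laplacian_def using u \<open>open S\<close> by (intro continuous_intros) (auto simp: Ck_on_2_iff)
  define W where "W = {x \<in> S. laplacian u x - f (u x) \<noteq> 0}"
  have "continuous_on S (\<lambda>x. laplacian u x - f (u x))"
    by (intro continuous_intros cont_lap continuous_on_compose2[OF f cont_u]) simp
  then have "open (S \<inter> (\<lambda>x. laplacian u x - f (u x)) -` (- {0}))"
    using \<open>open S\<close> by (intro continuous_open_preimage) auto
  also have "S \<inter> (\<lambda>x. laplacian u x - f (u x)) -` (- {0}) = W"
    by (auto simp: W_def)
  finally have "open W" .
  have grad: "partial_deriv i u x = 0" if "x \<in> W" for i x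
    using zero[of x i] that by (auto simp: W_def)
  \<comment> \<open>The first derivatives vanish on the whole open set \<open>W\<close>, hence so do
    their derivatives there.\<close>
  have lap: "laplacian u x = 0" if "x \<in> W" for x
    unfolding laplacian_def
    by (intro sum.neutral ballI partial_deriv_eq_0_if_zero_on_open[OF \<open>open W\<close> that] grad)
  \<comment> \<open>\<open>W\<close> is open, but its closedness in \<open>S\<close> is not evident.
    \<open>T\<close> is cut out by two equations between continuous functions, so it is closed in
    \<open>S\<close>; and it lies in \<open>W\<close>, because on \<open>T\<close> the difference
    \<open>laplacian u x - f (u x)\<close> has the nonzero value \<open>- f (u x0)\<close>.\<close>
  define T where "T = {x \<in> S. u x = u x0 \<and> laplacian u x = 0}"
  have "x0 \<in> W"
    using x0 by (simp add: W_def)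
  then have "x0 \<in> T"
    using x0(1) lap by (simp add: T_def)
  have "f (u x0) \<noteq> 0"
    using x0(2) lap[OF \<open>x0 \<in> W\<close>] by simp
  then have "T \<subseteq> W"
    by (auto simp: T_def W_def)
  have "open T"
    unfolding open_contains_ball
  proof
    fix x assume "x \<in> T"
    then obtain e where e: "0 < e" "ball x e \<subseteq> W"
      using \<open>T \<subseteq> W\<close> \<open>open W\<close> open_contains_ball by blast
    \<comment> \<open>The ball lies in \<open>W\<close>, where the gradient vanishes, and it is
      convex, so \<open>u\<close> is constant on it.\<close>
    have const: "u y = u x" if "y \<in> ball x e" for y
    proof (rule has_derivative_zero_unique[OF convex_ball _ that])
      show "x \<in> ball x e"
        using e(1) by simp
      fix z assume "z \<in> ball x e"
      then have "z \<in> W"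
        using e(2) by blast
      then show "(u has_derivative (\<lambda>h. 0)) (at z within ball x e)"
        by (intro has_derivative_at_withinI[OF has_derivative_zero_if_partial_derivs_zero] diff grad)
          (simp_all add: W_def)
    qed
    have "y \<in> T" if "y \<in> ball x e" for y
    proof -
      have "y \<in> W"
        using e(2) that by blast
      then show ?thesis
        using const[OF that] lap[OF \<open>y \<in> W\<close>] \<open>x \<in> T\<close> by (simp add: T_def W_def)
    qed
    then show "\<exists>e>0. ball x e \<subseteq> T"
      using e(1) by blast
  qed
  then have "openin (top_of_set S) T"
    by (auto simp: openin_open_eq[OF \<open>open S\<close>] T_def)
  moreover have "closedin (top_of_set S) T"
  proof -
    have "T = {x \<in> S. u x = u x0} \<inter> {x \<in> S. laplacian u x = 0}"
      by (auto simp: T_def)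
    then show ?thesis
      using continuous_closedin_preimage_constant[OF cont_u, of "u x0"]
        continuous_closedin_preimage_constant[OF cont_lap, of 0]
      by (simp add: closedin_Int)
  qed
  ultimately have "T = S"
    using \<open>connected S\<close> \<open>x0 \<in> T\<close> by (auto simp: connected_clopen)
  then show "u constant_on S"
    by (auto simp: constant_on_def T_def)
qed

text \<open>The continuous extension of a constant function to the closure keeps the constant value,
  in particular on the frontier. In contrapositive form this rules out the constant alternative of
  the dichotomy.\<close>

lemma boundary_values_constant:
  assumes "has_boundary_values \<Omega> u g" and "u constant_on \<Omega>"
  shows "g constant_on frontier \<Omega>"
proof -
  obtain U where U: "continuous_on (closure \<Omega>) U" "\<And>x. x \<in> \<Omega> \<Longrightarrow> U x = u x"
      "\<And>x. x \<in> frontier \<Omega> \<Longrightarrow> U x = g x"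
    using assms(1) by (auto simp: has_boundary_values_def)
  obtain c where "\<And>x. x \<in> \<Omega> \<Longrightarrow> u x = c"
    using assms(2) by (auto simp: constant_on_def)
  then have "U x = c" if "x \<in> closure \<Omega>" for x
    using continuous_constant_on_closure[OF U(1) _ that] U(2) by simp
  then show ?thesis
    unfolding constant_on_def using U(3) by (metis DiffD1 frontier_def)
qed

theorem theorem2:
  fixes \<Omega> :: "(real^'n) set" and F :: "real \<Rightarrow> real" and g :: "real^'n \<Rightarrow> real"
  assumes "domain \<Omega>" and "bounded \<Omega>"
    and "F C1_differentiable_on UNIV"
    and "continuous_on (frontier \<Omega>) g" and "\<not> g constant_on frontier \<Omega>"
  shows "\<forall>u\<in>admissible \<Omega> g.
    (\<forall>x\<in>\<Omega>. laplacian u x = deriv F (u x)) \<longleftrightarrow>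
    (\<forall>i. \<forall>x\<in>\<Omega>. (\<Sum>j\<in>UNIV. partial_deriv j
        (\<lambda>y. partial_deriv i u y * partial_deriv j u y
              - kronecker i j * lagrangian F (u y) (gradient u y)) x) = 0)"
proof
  fix u assume "u \<in> admissible \<Omega> g"
  then have u: "Ck_on 2 \<Omega> u" "has_boundary_values \<Omega> u g"
    by (auto simp: admissible_def)
  have \<Omega>: "open \<Omega>" "connected \<Omega>"
    using assms(1) by (auto simp: domain_def)
  obtain D where D: "\<And>x. (F has_real_derivative D x) (at x)" "continuous_on UNIV D"
    using assms(3)
    by (auto simp: C1_differentiable_on_def has_real_derivative_iff_has_vector_derivative)
  have "deriv F = D"
    using D(1) by (auto intro: DERIV_imp_deriv)
  have "\<not> u constant_on \<Omega>"
    using boundary_values_constant[OF u(2)] assms(5) by blast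
  \<comment> \<open>From left to right the first factor vanishes; the converse is the dichotomy with
    its constant case excluded.\<close>
  then have "(\<forall>x\<in>\<Omega>. laplacian u x = D (u x)) \<longleftrightarrow>
      (\<forall>i. \<forall>x\<in>\<Omega>. (laplacian u x - D (u x)) * partial_deriv i u x = 0)"
    using constant_or_euler_lagrange[OF \<Omega> u(1) D(2)] by auto
  then show "(\<forall>x\<in>\<Omega>. laplacian u x = deriv F (u x)) \<longleftrightarrow>
    (\<forall>i. \<forall>x\<in>\<Omega>. (\<Sum>j\<in>UNIV. partial_deriv j
        (\<lambda>y. partial_deriv i u y * partial_deriv j u y
              - kronecker i j * lagrangian F (u y) (gradient u y)) x) = 0)"
    by (simp add: noether_divergence[OF \<Omega>(1) _ u(1) D(1)] \<open>deriv F = D\<close> cong: ball_cong)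
qed

end
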